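(* Let $y \in \mathbb{R}^n$ and $W \in \mathbb{R}^{k \times n}$, and let $x^*(W) = \arg\min_{x \in \mathbb{R}^n} \frac{1}{2}\|x - y\|_2^2 + \|Wx\|_1$. Let $k_{=0} = \{ i \in \{1,\dots,k\} : (W x^*(W))_i = 0\}$ and $k_{\neq 0} = \{ i \in \{1,\dots,k\} : (W x^*(W))_i \neq 0\}$. Let $W_0$ and $W_{\pm}$ be the matrices consisting of the rows of $W$ with indices in $k_{=0}$ and $k_{\neq 0}$, respectively, and let $s = R\,\mathrm{sign}(W x^*(W))$, where $R$ is the row selection matrix retaining exactly the entries with index in $k_{\neq 0}$ (so $s$ is the vector of nonzero entries of $\mathrm{sign}(W x^*(W))$). Then $$x^*(W) = P_{\mathcal{N}(W_0)}\,\bigl(y - W_{\pm}^{\mathsf{T}} s\bigr),$$ where $P_{\mathcal{N}(W_0)} = I - W_0^{\dagger} W_0$ is the orthogonal projector onto the nullspace of $W_0$.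
   Context: The objective $x \mapsto \frac12\|x-y\|_2^2+\|Wx\|_1$ is strictly convex and has a unique global minimizer, so $x^*(W)$ is well defined. The function $\mathrm{sign}$ acts entrywise, with $\mathrm{sign}(z)_i = -1$ if $z_i<0$, $0$ if $z_i = 0$, and $1$ if $z_i>0$. $W_0^{\dagger}$ denotes the Moore-Penrose pseudoinverse. Rows are kept in the same order as in $W$. If $k_{=0}$ is empty, $P_{\mathcal{N}(W_0)} = I$; if $k_{\neq 0}$ is empty, $W_{\pm}^{\mathsf{T}} s = 0$. *)

theory Defs
  imports
    Complex_Main
    "Jordan_Normal_Form.Matrix"
    "Jordan_Normal_Form.Matrix_Kernel"
    "Jordan_Normal_Form.DL_Submatrix"
begin

definition norm2_vec :: "real vec \<Rightarrow> real" where
  "norm2_vec v = sqrt (v \<bullet> v)"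

definition norm1_vec :: "real vec \<Rightarrow> real" where
  "norm1_vec v = (\<Sum>i<dim_vec v. \<bar>v $ i\<bar>)"

definition objective :: "real mat \<Rightarrow> real vec \<Rightarrow> real vec \<Rightarrow> real" where
  "objective W y x = 1/2 * (norm2_vec (x - y))\<^sup>2 + norm1_vec (W *\<^sub>v x)"

text \<open>The objective is strictly convex and coercive, so it has exactly one minimizer over
  the vectors of length \<open>dim_col W\<close> and \<open>ARG_MIN\<close> denotes that one.\<close>

definition x_star :: "real mat \<Rightarrow> real vec \<Rightarrow> real vec" where
  "x_star W y = (ARG_MIN (objective W y) x. x \<in> carrier_vec (dim_col W))"

text \<open>The four Penrose conditions; over the reals the conjugate transpose is the transpose.
  Exactly one matrix satisfies them, also when \<open>A\<close> has no rows or no columns.\<close>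

definition is_pseudoinverse :: "real mat \<Rightarrow> real mat \<Rightarrow> bool" where
  "is_pseudoinverse A X \<longleftrightarrow>
     X \<in> carrier_mat (dim_col A) (dim_row A) \<and>
     A * X * A = A \<and> X * A * X = X \<and>
     transpose_mat (A * X) = A * X \<and> transpose_mat (X * A) = X * A"

definition pseudoinverse :: "real mat \<Rightarrow> real mat" where
  "pseudoinverse A = (THE X. is_pseudoinverse A X)"

definition null_projector :: "real mat \<Rightarrow> real mat" where
  "null_projector A = 1\<^sub>m (dim_col A) - pseudoinverse A * A"

definition is_orthogonal_projector :: "nat \<Rightarrow> real mat \<Rightarrow> real vec set \<Rightarrow> bool" where
  "is_orthogonal_projector n P U \<longleftrightarrow>
     P \<in> carrier_mat n n \<and> P * P = P \<and> transpose_mat P = P \<and>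
     (\<lambda>v. P *\<^sub>v v) ` carrier_vec n = U"

text \<open>Indices start at 0. \<^const>\<open>submatrix\<close> keeps the selected rows in increasing order of
  their index, and the column set \<^term>\<open>UNIV\<close> keeps every column.\<close>

definition select_rows :: "real mat \<Rightarrow> nat set \<Rightarrow> real mat" where
  "select_rows A I = submatrix A I UNIV"

definition sign_vec :: "real vec \<Rightarrow> real vec" where
  "sign_vec v = map_vec sgn v"

end

theory Submission
  imports Defs "HOL-Analysis.Function_Topology"
begin

text \<open>Let \<open>P\<close> be the projector onto the nullspace of \<open>W\<^sub>0\<close> and \<open>u = y - W\<^sub>\<plusminus>\<^sup>T s\<close>. For \<open>d\<close> in that
  nullspace, \<open>\<parallel>W (x + t d)\<parallel>\<^sub>1\<close> is affine in \<open>t\<close> near \<open>0\<close> with slope \<open>\<langle>W\<^sub>\<plusminus>\<^sup>T s, d\<rangle>\<close>, so minimality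
  of \<open>x\<close> gives \<open>\<langle>u - x, d\<rangle> = 0\<close>. Taking \<open>d = P (u - x)\<close> yields \<open>P u = P x = x\<close>.\<close>

section \<open>The Moore-Penrose pseudoinverse\<close>

text \<open>Wedderburn rank reduction: subtracting \<open>A E A\<close>, where \<open>E\<close> has the single entry \<open>1 / A\<^sub>i\<^sub>j\<close>
  at position \<open>(j, i)\<close>, clears row \<open>i\<close> and keeps zero rows zero.\<close>

lemma generalized_inverse_exists:
  fixes A :: "'a::field mat"
  assumes "A \<in> carrier_mat m n"
  shows "\<exists>G \<in> carrier_mat n m. A * G * A = A"
  using assms
proof (induction "card {i. i < m \<and> row A i \<noteq> 0\<^sub>v n}" arbitrary: A rule: less_induct)
  case less
  note A[simp] = less.prems
  show ?case
  proof (cases "\<forall>i<m. row A i = 0\<^sub>v n")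
    case True
    have "A = 0\<^sub>m m n"
    proof (rule eq_matI)
      fix i j assume "i < dim_row (0\<^sub>m m n)" "j < dim_col (0\<^sub>m m n)"
      then show "A $$ (i, j) = 0\<^sub>m m n $$ (i, j)"
        using True A by (metis carrier_matD index_row(1) index_zero_mat index_zero_vec(1))
    qed (use carrier_matD[OF A] in auto)
    then show ?thesis by (intro bexI[of _ "0\<^sub>m n m"]) auto
  next
    case False
    then obtain i where i: "i < m" "row A i \<noteq> 0\<^sub>v n" by blast
    then obtain j where j: "j < n" "A $$ (i, j) \<noteq> 0"
      using A by (metis (no_types, lifting) carrier_matD eq_vecI index_row index_zero_vec)
    define E where "E = mat n m (\<lambda>(p, q). if p = j \<and> q = i then 1 / A $$ (i, j) else 0)"
    have E[simp]: "E \<in> carrier_mat n m" by (simp add: E_def)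
    define B where "B = A - A * E * A"
    have B[simp]: "B \<in> carrier_mat m n"
      unfolding B_def by (intro minus_carrier_mat mult_carrier_mat[of _ m m] mult_carrier_mat[of _ m n] A E)
    \<comment> \<open>\<open>A * E\<close> is column \<open>j\<close> of \<open>A\<close> divided by
      the pivot and placed in column \<open>i\<close>; so \<open>A * E * A\<close> is column
      \<open>j\<close> times row \<open>i\<close> over the pivot.\<close>
    have AE: "(A * E) $$ (p, q) = (if q = i then A $$ (p, j) / A $$ (i, j) else 0)"
      if "p < m" "q < m" for p q
      using that i j carrier_matD[OF A] by (simp add: E_def scalar_prod_def sum.If_cases if_distrib if_distribR cong: if_cong)
    have AEA: "(A * E * A) $$ (p, q) = A $$ (p, j) * A $$ (i, q) / A $$ (i, j)"
      if "p < m" "q < n" for p q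
    proof -
      have "(A * E * A) $$ (p, q) = (\<Sum>r = 0..<m. (A * E) $$ (p, r) * A $$ (r, q))"
        using that carrier_matD[OF A] carrier_matD[OF E] by (simp add: scalar_prod_def)
      also have "\<dots> = (\<Sum>r = 0..<m. if r = i then A $$ (p, j) / A $$ (i, j) * A $$ (i, q) else 0)"
        by (intro sum.cong) (use AE that in auto)
      finally show ?thesis using i by simp
    qed
    have Bi: "B $$ (p, q) = A $$ (p, q) - A $$ (p, j) * A $$ (i, q) / A $$ (i, j)"
      if "p < m" "q < n" for p q
    proof -
      have "A * E * A \<in> carrier_mat m n"
        by (intro mult_carrier_mat[of _ m m] mult_carrier_mat[of _ m n] A E)
      from carrier_matD[OF this] show ?thesis using AEA[OF that] that by (simp add: B_def del: index_mult_mat)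
    qed
    have B_row: "row B p = 0\<^sub>v n" if p: "p < m" "row A p = 0\<^sub>v n" for p
    proof -
      have "A $$ (p, q) = 0" if "q < n" for q
        using that p A by (metis carrier_matD index_row(1) index_zero_vec(1))
      then show ?thesis
        using p j carrier_matD[OF B] by (intro eq_vecI) (auto simp: Bi)
    qed
    have "row B i = 0\<^sub>v n" using i j carrier_matD[OF B] by (intro eq_vecI) (auto simp: Bi)
    then have "{p. p < m \<and> row B p \<noteq> 0\<^sub>v n} \<subset> {p. p < m \<and> row A p \<noteq> 0\<^sub>v n}"
      using B_row i by blast
    then have "card {p. p < m \<and> row B p \<noteq> 0\<^sub>v n} < card {p. p < m \<and> row A p \<noteq> 0\<^sub>v n}"
      by (intro psubset_card_mono) auto
    from less.hyps[OF this B] obtain G where G[simp]: "G \<in> carrier_mat n m" and BGB: "B * G * B = B"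
      by blast
    \<comment> \<open>The outer factors turn \<open>A * H * A\<close> into
      \<open>B * G * B = B\<close>, so that
      \<open>A * (E + H) * A = A * E * A + B = A\<close>.\<close>
    define H where "H = (1\<^sub>m n - E * A) * G * (1\<^sub>m m - A * E)"
    have c[simp]: "E * A \<in> carrier_mat n n" "A * E \<in> carrier_mat m m"
        "A * E * A \<in> carrier_mat m n"
        "1\<^sub>m n - E * A \<in> carrier_mat n n" "1\<^sub>m m - A * E \<in> carrier_mat m m"
      by (intro minus_carrier_mat mult_carrier_mat[OF E A] mult_carrier_mat[OF A E]
        mult_carrier_mat[OF mult_carrier_mat[OF A E] A])+
    have H[simp]: "H \<in> carrier_mat n m" unfolding H_def by (intro mult_carrier_mat[of _ n m] mult_carrier_mat[of _ n n]) auto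
    have "A * (1\<^sub>m n - E * A) = B"
      by (simp add: mult_minus_distrib_mat[of _ m n _ n] B_def assoc_mult_mat[OF A E A]
        right_mult_one_mat[OF A])
    moreover have "(1\<^sub>m m - A * E) * A = B"
      by (simp add: minus_mult_distrib_mat[of _ m m _ _ n] B_def left_mult_one_mat[OF A])
    moreover have "A * H * A = (A * (1\<^sub>m n - E * A)) * G * ((1\<^sub>m m - A * E) * A)"
      unfolding H_def using A c G by (smt (verit) assoc_mult_mat mult_carrier_mat)
    ultimately have AHA: "A * H * A = B" using BGB by simp
    have "A * (E + H) * A = A * E * A + A * H * A"
      by (simp add: mult_carrier_mat[OF A H] mult_add_distrib_mat[of _ m n _ m] add_mult_distrib_mat[of _ m m _ _ n])
    also have "\<dots> = A" unfolding AHA B_def using carrier_matD[OF A] carrier_matD[OF c(3)] by (intro eq_matI) auto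
    finally show ?thesis by (intro bexI[of _ "E + H"]) auto
  qed
qed

text \<open>The diagonal of \<open>M^T M\<close> holds the squared Euclidean norms of the columns of
  \<open>M\<close>, and real squares sum to zero only if each of them is zero.\<close>

lemma transpose_mult_self_eq_0:
  fixes M :: "real mat"
  assumes M: "M \<in> carrier_mat m n" and 0: "transpose_mat M * M = 0\<^sub>m n n"
  shows "M = 0\<^sub>m m n"
proof (rule eq_matI)
  fix i j assume "i < dim_row (0\<^sub>m m n :: real mat)" "j < dim_col (0\<^sub>m m n :: real mat)"
  then have ij: "i < m" "j < n" by auto
  have "(transpose_mat M * M) $$ (j, j) = 0" using 0 ij by simp
  then have "(\<Sum>r = 0..<m. M $$ (r, j) * M $$ (r, j)) = 0"
    using M ij by (simp add: scalar_prod_def)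
  then have "M $$ (i, j) * M $$ (i, j) = 0" using ij by (subst (asm) sum_nonneg_eq_0_iff) auto
  then show "M $$ (i, j) = 0\<^sub>m m n $$ (i, j)" using ij by simp
qed (use M in auto)

text \<open>The leading \<open>A^T\<close> in \<open>SGS\<close> can be cancelled: for
  \<open>M = A G A^T A - A\<close> the hypothesis says \<open>A^T M = 0\<close>, and both terms of
  \<open>M^T M\<close> end in \<open>A^T M\<close>.\<close>

lemma gram_generalized_inverse:
  fixes A :: "real mat"
  assumes A[simp]: "A \<in> carrier_mat m n" and G[simp]: "G \<in> carrier_mat n n"
    and SGS: "transpose_mat A * A * G * (transpose_mat A * A) = transpose_mat A * A"
  shows "A * G * transpose_mat A * A = A"
proof -
  let ?T = "transpose_mat A"
  define M where "M = A * G * ?T * A - A"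
  have T[simp]: "?T \<in> carrier_mat n m" by simp
  have c[simp]: "A * G \<in> carrier_mat m n" "A * G * ?T \<in> carrier_mat m m" "A * G * ?T * A \<in> carrier_mat m n"
    by (intro mult_carrier_mat[of _ m n] mult_carrier_mat[of _ m m] A G T)+
  have M[simp]: "M \<in> carrier_mat m n" by (simp add: M_def minus_carrier_mat)
  have "?T * (A * G * ?T * A) = ?T * A * G * (?T * A)"
    using A G T by (smt (verit) assoc_mult_mat mult_carrier_mat)
  then have TM: "?T * M = 0\<^sub>m n n"
    unfolding M_def by (subst mult_minus_distrib_mat[of _ n m _ n]) (auto simp: SGS minus_r_inv_mat[OF mult_carrier_mat[OF T A]])
  have "transpose_mat M * M = transpose_mat (A * G * ?T * A) * M - ?T * M"
    by (subst (1) M_def, subst transpose_minus[of _ m n], simp_all)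
       (subst minus_mult_distrib_mat[of _ n m _ _ n], auto)
  also have "transpose_mat (A * G * ?T * A) = ?T * (A * (transpose_mat G * ?T))"
    by (simp add: transpose_mult[of _ m m _ n] transpose_mult[of _ m n _ m] transpose_mult[of _ m n _ n])
  also have "\<dots> * M = ?T * (A * (transpose_mat G * (?T * M)))"
  proof -
    have GT: "transpose_mat G \<in> carrier_mat n n" by simp
    have GTT: "transpose_mat G * ?T \<in> carrier_mat n m" by (rule mult_carrier_mat[OF GT T])
    have AGTT: "A * (transpose_mat G * ?T) \<in> carrier_mat m m" by (rule mult_carrier_mat[OF A GTT])
    show ?thesis
      by (simp only: assoc_mult_mat[OF T AGTT M] assoc_mult_mat[OF A GTT M] assoc_mult_mat[OF GT T M])
  qed
  also have "\<dots> - ?T * M = 0\<^sub>m n n"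
    unfolding TM
    by (simp add: right_mult_zero_mat[OF T] right_mult_zero_mat[OF A]
      right_mult_zero_mat[of "transpose_mat G" n n])
  finally have "M = 0\<^sub>m m n" by (rule transpose_mult_self_eq_0[OF M])
  then have "A * G * ?T * A - A = 0\<^sub>m m n" by (simp add: M_def)
  then show ?thesis using A c
    by (intro eq_matI) (metis carrier_matD eq_iff_diff_eq_0 index_minus_mat(1) index_zero_mat(1), auto)
qed

text \<open>The witness is \<open>G A^T\<close> with \<open>G\<close> a generalized inverse of the
  Gram matrix \<open>A^T A\<close>. Nothing makes \<open>G\<close> symmetric, so the symmetry of
  \<open>Q = A G A^T\<close> is derived from \<open>Q = Q^T Q\<close>.\<close>

lemma least_squares_inverse_exists:
  fixes A :: "real mat"
  assumes A[simp]: "A \<in> carrier_mat m n"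
  shows "\<exists>X \<in> carrier_mat n m. A * X * A = A \<and> transpose_mat (A * X) = A * X"
proof -
  let ?T = "transpose_mat A"
  have T[simp]: "?T \<in> carrier_mat n m" by simp
  have TA: "?T * A \<in> carrier_mat n n" by (rule mult_carrier_mat[OF T A])
  obtain G where G[simp]: "G \<in> carrier_mat n n"
    and SGS: "?T * A * G * (?T * A) = ?T * A"
    using generalized_inverse_exists[OF TA] by blast
  define Q where "Q = A * G * ?T"
  have X[simp]: "G * ?T \<in> carrier_mat n m" by (rule mult_carrier_mat[OF G T])
  have Q[simp]: "Q \<in> carrier_mat m m"
    unfolding Q_def by (intro mult_carrier_mat[of _ m n] A G T)
  have AX: "A * (G * ?T) = Q"
    unfolding Q_def by (rule assoc_mult_mat[symmetric, OF A G T])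
  have QA: "Q * A = A" unfolding Q_def by (rule gram_generalized_inverse[OF A G SGS])
  have TG: "transpose_mat G \<in> carrier_mat n n" by simp
  \<comment> \<open>Transposing \<open>SGS\<close> shows that \<open>G^T\<close> is also a
    generalized inverse of the Gram matrix. This yields \<open>Q^T A = A\<close>, hence
    \<open>Q^T Q = Q^T A G A^T = Q\<close>.\<close>
  have "?T * A * transpose_mat G * (?T * A) = transpose_mat (?T * A * G * (?T * A))"
    using TA by (simp add: transpose_mult[of _ n n _ n] transpose_mult[of _ n m _ n]
      assoc_mult_mat[of _ n n _ n _ n] mult_carrier_mat[of _ n n])
  also have "\<dots> = ?T * A" unfolding SGS by (simp add: transpose_mult[of _ n m _ n])
  finally have TQA: "A * transpose_mat G * ?T * A = A"
    by (rule gram_generalized_inverse[OF A TG])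
  have "transpose_mat Q = A * (transpose_mat G * ?T)"
    unfolding Q_def
    by (simp add: transpose_mult[of _ m n _ m] transpose_mult[of _ m n _ n] mult_carrier_mat[of _ m n])
  also have "\<dots> = A * transpose_mat G * ?T"
    by (rule assoc_mult_mat[symmetric, OF A TG T])
  finally have "transpose_mat Q * A = A" using TQA by simp
  moreover have "transpose_mat Q * Q = transpose_mat Q * A * (G * ?T)"
    unfolding AX[symmetric] by (rule assoc_mult_mat[symmetric, of _ m m _ n _ m]) (auto simp: AX)
  ultimately have QQ: "transpose_mat Q * Q = Q" using AX by simp
  have "transpose_mat Q = transpose_mat (transpose_mat Q * Q)" unfolding QQ ..
  also have "\<dots> = transpose_mat Q * Q" by (simp add: transpose_mult[of _ m m _ m])
  finally have "transpose_mat Q = Q" unfolding QQ .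
  then show ?thesis using AX QA by (intro bexI[of _ "G * ?T"]) auto
qed

text \<open>The symmetry conditions let transposition swap factors:
  \<open>A X = (A Y A X)^T = A X A Y = A Y\<close>, and likewise \<open>X A = Y A\<close>. Then
  \<open>X = X A X = Y A Y = Y\<close>.\<close>

lemma is_pseudoinverse_unique:
  assumes X: "is_pseudoinverse A X" and Y: "is_pseudoinverse A Y"
  shows "X = Y"
proof -
  let ?m = "dim_row A" and ?n = "dim_col A"
  have A[simp]: "A \<in> carrier_mat ?m ?n" by simp
  have [simp]: "X \<in> carrier_mat ?n ?m" "Y \<in> carrier_mat ?n ?m"
    using X Y by (auto simp: is_pseudoinverse_def)
  have [simp]: "A * X \<in> carrier_mat ?m ?m" "A * Y \<in> carrier_mat ?m ?m"
    "X * A \<in> carrier_mat ?n ?n" "Y * A \<in> carrier_mat ?n ?n"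
    by (auto intro!: mult_carrier_mat[of _ ?m ?n] mult_carrier_mat[of _ ?n ?m])
  have "A * X = transpose_mat (A * Y * A * X)"
    using X Y by (simp add: is_pseudoinverse_def)
  also have "\<dots> = transpose_mat (A * X) * transpose_mat (A * Y)"
    by (simp add: transpose_mult[symmetric, of _ ?m ?m _ ?m] assoc_mult_mat[of _ ?m ?m _ ?n _ ?m])
  also have "\<dots> = A * X * (A * Y)"
    using X Y by (simp add: is_pseudoinverse_def)
  also have "\<dots> = A * X * A * Y"
    by (rule assoc_mult_mat[symmetric, of _ ?m ?m _ ?n _ ?m]) auto
  finally have AX: "A * X = A * Y" using X by (simp add: is_pseudoinverse_def)
  have "X * A = transpose_mat (X * (A * Y * A))"
    using X Y by (simp add: is_pseudoinverse_def)
  also have "\<dots> = transpose_mat (Y * A) * transpose_mat (X * A)"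
    by (simp add: transpose_mult[symmetric, of _ ?n ?n _ ?n] assoc_mult_mat[of _ ?n ?m _ ?n _ ?n]
      assoc_mult_mat[of _ ?m ?n _ ?m _ ?n])
  also have "\<dots> = Y * (A * X * A)"
    using X Y by (simp add: is_pseudoinverse_def assoc_mult_mat[of _ ?n ?m _ ?n _ ?n]
      assoc_mult_mat[of _ ?m ?n _ ?m _ ?n])
  finally have XA: "X * A = Y * A" using X by (simp add: is_pseudoinverse_def)
  have "X = X * A * X" using X by (simp add: is_pseudoinverse_def)
  also have "\<dots> = Y * (A * X)" unfolding XA by (rule assoc_mult_mat[of _ ?n ?m _ ?n _ ?m]) auto
  also have "\<dots> = Y * A * Y" unfolding AX by (rule assoc_mult_mat[symmetric, of _ ?n ?m _ ?n _ ?m]) auto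
  also have "\<dots> = Y" using Y by (simp add: is_pseudoinverse_def)
  finally show ?thesis .
qed

text \<open>Least-squares inverses \<open>X\<close> of \<open>A\<close> and \<open>Z\<close> of
  \<open>A^T\<close> supply one symmetry condition each. With \<open>Y = Z^T\<close>, the product
  \<open>Y A X\<close> inherits both, since \<open>A (Y A X) = A X\<close> and
  \<open>(Y A X) A = Y A\<close>.\<close>

lemma is_pseudoinverse_pseudoinverse: "is_pseudoinverse A (pseudoinverse A)"
proof -
  let ?m = "dim_row A" and ?n = "dim_col A"
  have A[simp]: "A \<in> carrier_mat ?m ?n" by simp
  have T: "transpose_mat A \<in> carrier_mat ?n ?m" by simp
  obtain X where X[simp]: "X \<in> carrier_mat ?n ?m" and AXA: "A * X * A = A"
    and AX: "transpose_mat (A * X) = A * X"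
    using least_squares_inverse_exists[OF A] by blast
  obtain Z where Z[simp]: "Z \<in> carrier_mat ?m ?n"
    and TZT: "transpose_mat A * Z * transpose_mat A = transpose_mat A"
    and TZ: "transpose_mat (transpose_mat A * Z) = transpose_mat A * Z"
    using least_squares_inverse_exists[OF T] by blast
  define Y where "Y = transpose_mat Z"
  have Y[simp]: "Y \<in> carrier_mat ?n ?m" by (simp add: Y_def)
  have YA: "transpose_mat (Y * A) = Y * A"
    using TZ by (simp add: Y_def transpose_mult[of _ ?n ?m _ ?n])
  have "transpose_mat A * Z \<in> carrier_mat ?n ?n" by (rule mult_carrier_mat[OF T Z])
  then have "A * (Y * A) = transpose_mat (transpose_mat A * Z * transpose_mat A)"
    by (simp add: Y_def transpose_mult[of _ ?n ?n _ ?m] transpose_mult[of _ ?n ?m _ ?n])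
  then have AYA: "A * (Y * A) = A" unfolding TZT by simp
  txt \<open>\<open>X\<close> satisfies the Penrose conditions on \<open>A X\<close>, and \<open>Y\<close> those on \<open>Y A\<close>.\<close>
  define P where "P = Y * A * X"
  have [simp]: "Y * A \<in> carrier_mat ?n ?n" by (rule mult_carrier_mat[OF Y A])
  have [simp]: "A * X \<in> carrier_mat ?m ?m" by (rule mult_carrier_mat[OF A X])
  have P[simp]: "P \<in> carrier_mat ?n ?m" unfolding P_def by (rule mult_carrier_mat[of _ _ ?n]) auto
  have AP: "A * P = A * X"
    unfolding P_def by (subst assoc_mult_mat[symmetric, of _ ?m ?n _ ?n _ ?m]) (auto simp: AYA)
  have PA: "P * A = Y * A"
  proof -
    have "P * A = Y * (A * X) * A"
      unfolding P_def using assoc_mult_mat[OF Y A X] by simp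
    also have "\<dots> = Y * (A * X * A)" by (rule assoc_mult_mat[of _ ?n ?m _ ?m _ ?n]) auto
    finally show ?thesis unfolding AXA .
  qed
  have "P * A * P = Y * (A * P)"
    unfolding PA by (rule assoc_mult_mat[of _ ?n ?m _ ?n _ ?m]) auto
  also have "\<dots> = P"
    unfolding AP unfolding P_def by (rule assoc_mult_mat[symmetric, of _ ?n ?m _ ?n _ ?m]) auto
  finally have "P * A * P = P" .
  then have pinv: "is_pseudoinverse A P"
    using AP PA AXA AX YA by (simp add: is_pseudoinverse_def)
  show ?thesis
    unfolding pseudoinverse_def by (rule theI[where P = "is_pseudoinverse A", OF pinv is_pseudoinverse_unique[OF _ pinv]])
qed

text \<open>For \<open>P = I - X A\<close>, the identity \<open>A P = 0\<close> puts the image of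
  \<open>P\<close> inside the nullspace, and \<open>P v = v - X (A v)\<close> fixes every vector
  there. Symmetry of \<open>P\<close> is the Penrose condition on \<open>X A\<close>.\<close>

lemma null_projector_orthogonal:
  assumes A[simp]: "A \<in> carrier_mat m n"
  shows "is_orthogonal_projector n (null_projector A) (mat_kernel A)"
    and "v \<in> mat_kernel A \<Longrightarrow> null_projector A *\<^sub>v v = v"
proof -
  define X where "X = pseudoinverse A"
  define P where "P = null_projector A"
  have X[simp]: "X \<in> carrier_mat n m" and AXA: "A * X * A = A"
    and XA: "transpose_mat (X * A) = X * A"
    using is_pseudoinverse_pseudoinverse[of A] carrier_matD[OF A]
    by (auto simp: is_pseudoinverse_def X_def)
  have c[simp]: "X * A \<in> carrier_mat n n" by (rule mult_carrier_mat[OF X A])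
  have P_eq: "P = 1\<^sub>m n - X * A"
    using carrier_matD[OF A] by (simp add: P_def null_projector_def X_def)
  have P[simp]: "P \<in> carrier_mat n n" unfolding P_eq by (rule minus_carrier_mat[OF c])
  have "A * P = A - A * (X * A)"
    unfolding P_eq by (subst mult_minus_distrib_mat[of _ m n _ n]) (auto simp: right_mult_one_mat[OF A])
  also have "A * (X * A) = A"
    using assoc_mult_mat[OF A X A] AXA by simp
  finally have AP: "A * P = 0\<^sub>m m n" using minus_r_inv_mat[OF A] by simp
  have Pv: "P *\<^sub>v v = v - X *\<^sub>v (A *\<^sub>v v)" if "v \<in> carrier_vec n" for v
    unfolding P_eq using that A X
    by (subst minus_mult_distrib_mat_vec[of _ n n]) (auto simp: assoc_mult_mat_vec[OF X A])
  have fixed: "P *\<^sub>v v = v" if "v \<in> mat_kernel A" for v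
  proof -
    have v: "v \<in> carrier_vec n" "A *\<^sub>v v = 0\<^sub>v m" using mat_kernelD[OF A that] by auto
    have "X *\<^sub>v 0\<^sub>v m = 0\<^sub>v n" using carrier_matD[OF X] by (intro eq_vecI) auto
    then show ?thesis using Pv[OF v(1)] v by simp
  qed
  from this show "v \<in> mat_kernel A \<Longrightarrow> null_projector A *\<^sub>v v = v" by (simp add: P_def)
  have ker: "P *\<^sub>v v \<in> mat_kernel A" if "v \<in> carrier_vec n" for v
  proof (rule mat_kernelI[OF A])
    show "P *\<^sub>v v \<in> carrier_vec n" by (rule mult_mat_vec_carrier[OF P that])
    have "A *\<^sub>v (P *\<^sub>v v) = (A * P) *\<^sub>v v" by (rule assoc_mult_mat_vec[symmetric, OF A P that])
    then show "A *\<^sub>v (P *\<^sub>v v) = 0\<^sub>v m" using AP that by (intro eq_vecI) simp_all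
  qed
  \<comment> \<open>Only the left factor is expanded, so that \<open>A P = 0\<close> removes the
    second term.\<close>
  have "P * P = P - X * (A * P)"
    by (subst (1) P_eq, subst minus_mult_distrib_mat[of _ n n _ _ n]) (auto simp: assoc_mult_mat[of _ n m _ n _ n] left_mult_one_mat[OF P])
  then have "P * P = P"
    unfolding AP right_mult_zero_mat[OF X] using carrier_matD[OF P] by (auto intro!: eq_matI)
  moreover have "transpose_mat P = P"
    unfolding P_eq by (subst transpose_minus[of _ n n]) (auto simp: XA)
  moreover have "(\<lambda>v. P *\<^sub>v v) ` carrier_vec n = mat_kernel A"
    using ker fixed mat_kernel_carrier[OF A] by (auto simp: image_iff) (metis subsetD)
  ultimately show "is_orthogonal_projector n (null_projector A) (mat_kernel A)"
    unfolding is_orthogonal_projector_def P_def[symmetric] by simp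
qed

section \<open>The minimizer\<close>

text \<open>Coordinate form used for continuity and for expansion along a line; the square root
  cancels because the sum of squares is nonnegative.\<close>

lemma objective_sum:
  assumes "W \<in> carrier_mat k n" "y \<in> carrier_vec n" "x \<in> carrier_vec n"
  shows "objective W y x =
    1/2 * (\<Sum>j<n. (x $ j - y $ j)\<^sup>2) + (\<Sum>i<k. \<bar>\<Sum>j<n. W $$ (i, j) * x $ j\<bar>)"
proof -
  have "(x - y) \<bullet> (x - y) = (\<Sum>j<n. (x $ j - y $ j)\<^sup>2)"
    using assms by (simp add: scalar_prod_def power2_eq_square lessThan_atLeast0)
  moreover have "(W *\<^sub>v x) $ i = (\<Sum>j<n. W $$ (i, j) * x $ j)" if "i < k" for i
    using assms that by (simp add: scalar_prod_def lessThan_atLeast0)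
  moreover have "0 \<le> (\<Sum>j<n. (x $ j - y $ j)\<^sup>2)" by (intro sum_nonneg) auto
  ultimately show ?thesis
    using assms by (simp add: objective_def norm2_vec_def norm1_vec_def)
qed

text \<open>Tychonoff's theorem. Vectors of a given length do not form a type here, so the
  compactness argument runs on functions under the product topology.\<close>

lemma compact_box:
  fixes a b :: "'i \<Rightarrow> real"
  shows "compact {f. \<forall>i. f i \<in> {a i..b i}}"
proof -
  have "compactin (product_topology (\<lambda>_. euclidean) UNIV) (PiE UNIV (\<lambda>i. {a i..b i}))"
    by (subst compactin_PiE) auto
  moreover have "PiE UNIV (\<lambda>i. {a i..b i}) = {f. \<forall>i. f i \<in> {a i..b i}}" by auto
  ultimately show ?thesis by (simp add: euclidean_product_topology)
qed

text \<open>The extreme value theorem gives a minimizer on a box around \<open>y\<close>; outside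
  the box the quadratic term alone exceeds the objective at \<open>y\<close>.\<close>

lemma minimizer_exists:
  assumes W: "W \<in> carrier_mat k n" and y: "y \<in> carrier_vec n"
  shows "\<exists>x \<in> carrier_vec n. \<forall>z \<in> carrier_vec n. objective W y x \<le> objective W y z"
proof -
  define F where "F = (\<lambda>f. objective W y (vec n f))"
  have F_eq: "F f = 1/2 * (\<Sum>j<n. (f j - y $ j)\<^sup>2) + (\<Sum>i<k. \<bar>\<Sum>j<n. W $$ (i, j) * f j\<bar>)" for f
    unfolding F_def by (subst objective_sum[OF W y]) auto
  \<comment> \<open>\<open>M\<close> is the objective at \<open>y\<close> itself, since
    \<open>vec n\<close> applied to the entries of \<open>y\<close> returns
    \<open>y\<close>.\<close>
  define M where "M = F (($) y)"
  have M0: "0 \<le> M" unfolding M_def F_eq by (intro add_nonneg_nonneg sum_nonneg mult_nonneg_nonneg) auto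
  \<comment> \<open>The coordinates \<open>j >= n\<close> do not affect \<open>F\<close> but must be
    bounded for \<open>K\<close> to be compact; there \<open>y $ j\<close> is merely some fixed
    real.\<close>
  define K where "K = {f. \<forall>j. f j \<in> {y $ j - (M + 1) .. y $ j + (M + 1)}}"
  have "compact K" unfolding K_def by (rule compact_box)
  moreover have yK: "($) y \<in> K" using M0 by (auto simp: K_def)
  moreover have "continuous_on K F" unfolding F_eq
    by (intro continuous_intros continuous_on_product_then_coordinatewise[OF continuous_on_id])
  ultimately obtain f where f: "f \<in> K" "\<And>g. g \<in> K \<Longrightarrow> F f \<le> F g"
    using continuous_attains_inf[of K F] by blast
  have "F f \<le> objective W y z" if z: "z \<in> carrier_vec n" for z
  proof (cases "\<forall>j<n. \<bar>z $ j - y $ j\<bar> \<le> M + 1")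
    case True
    \<comment> \<open>Padding \<open>z\<close> with the centre of the box beyond length
      \<open>n\<close> places it in \<open>K\<close>.\<close>
    define g where "g = (\<lambda>j. if j < n then z $ j else y $ j)"
    have "g \<in> K" using True M0 by (auto simp: K_def g_def abs_le_iff algebra_simps)
    moreover have "vec n g = z" using z by (intro eq_vecI) (auto simp: g_def)
    ultimately show ?thesis using f(2)[of g] by (simp add: F_def)
  next
    case False
    then obtain j where j: "j < n" "M + 1 < \<bar>z $ j - y $ j\<bar>" by force
    have "F f \<le> M" unfolding M_def using f(2) yK by blast
    \<comment> \<open>The half-width \<open>M + 1\<close> is large enough because
      \<open>(M + 1)^2 / 2 = M + (M^2 + 1) / 2\<close>.\<close>
    also have "\<dots> \<le> 1/2 * (M + 1)\<^sup>2" using M0 by (simp add: power2_eq_square algebra_simps)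
    also have "(M + 1)\<^sup>2 \<le> (z $ j - y $ j)\<^sup>2"
      using j(2) M0 by (simp add: abs_le_square_iff[symmetric])
    also have "\<dots> \<le> (\<Sum>j<n. (z $ j - y $ j)\<^sup>2)"
      using j(1) by (intro member_le_sum) auto
    also have "1/2 * (\<Sum>j<n. (z $ j - y $ j)\<^sup>2) \<le> objective W y z"
      unfolding objective_sum[OF W y z] by (simp add: sum_nonneg)
    finally show ?thesis by simp
  qed
  then show ?thesis by (intro bexI[of _ "vec n f"]) (auto simp: F_def)
qed

text \<open>\<open>ARG_MIN\<close> is a choice operator, so it is the existence of a minimizer that
  gives \<open>x_star\<close> its defining property.\<close>

lemma x_star_minimizer:
  assumes W: "W \<in> carrier_mat k n" and y: "y \<in> carrier_vec n"
  shows "x_star W y \<in> carrier_vec n"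
    and "z \<in> carrier_vec n \<Longrightarrow> objective W y (x_star W y) \<le> objective W y z"
proof -
  obtain x where x: "x \<in> carrier_vec n" "\<And>z. z \<in> carrier_vec n \<Longrightarrow> objective W y x \<le> objective W y z"
    using minimizer_exists[OF W y] by blast
  have "x_star W y \<in> carrier_vec n \<and> (\<forall>z \<in> carrier_vec n. objective W y (x_star W y) \<le> objective W y z)"
    unfolding x_star_def
    by (rule arg_minI[where x = x]) (use W x in \<open>auto simp: not_less\<close>)
  then show "x_star W y \<in> carrier_vec n"
    and "z \<in> carrier_vec n \<Longrightarrow> objective W y (x_star W y) \<le> objective W y z"
    by auto
qed

section \<open>First-order condition at a minimizer\<close>

text \<open>If \<open>a\<close> is nonzero, \<open>a + t * b\<close> keeps the sign of
  \<open>a\<close> for small \<open>t\<close>; if \<open>a = 0\<close>, the hypothesis forces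
  \<open>b = 0\<close> and both sides vanish.\<close>

lemma abs_add_eq_sgn:
  fixes a b :: real
  assumes "a \<noteq> 0 \<or> b = 0"
  shows "eventually (\<lambda>t. \<bar>a + t * b\<bar> = \<bar>a\<bar> + t * (sgn a * b)) (nhds 0)"
proof (cases "a = 0")
  case False
  have "((\<lambda>t. a + t * b) \<longlongrightarrow> a + 0 * b) (nhds 0)"
    by (intro tendsto_intros filterlim_ident)
  then have lim: "((\<lambda>t. a + t * b) \<longlongrightarrow> a) (nhds 0)" by simp
  from False consider "a > 0" | "a < 0" by linarith
  then show ?thesis
  proof cases
    case 1
    show ?thesis using order_tendstoD(1)[OF lim 1] by eventually_elim (use 1 in auto)
  next
    case 2
    show ?thesis using order_tendstoD(2)[OF lim 2] by eventually_elim (use 2 in auto)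
  qed
qed (use assms in auto)

text \<open>Along a direction \<open>d\<close> on which the vanishing entries of \<open>W x\<close> stay zero, the objective
  is locally a quadratic polynomial, so its linear coefficient vanishes at a minimizer.\<close>

lemma stationary_direction:
  assumes W: "W \<in> carrier_mat k n" and y: "y \<in> carrier_vec n" and x: "x \<in> carrier_vec n"
    and min: "\<And>z. z \<in> carrier_vec n \<Longrightarrow> objective W y x \<le> objective W y z"
    and d: "d \<in> carrier_vec n"
    and stay: "\<And>i. i < k \<Longrightarrow> (W *\<^sub>v x) $ i = 0 \<Longrightarrow> (W *\<^sub>v d) $ i = 0"
  shows "(x - y) \<bullet> d + (\<Sum>i<k. sgn ((W *\<^sub>v x) $ i) * (W *\<^sub>v d) $ i) = 0"
proof -
  let ?L = "(x - y) \<bullet> d + (\<Sum>i<k. sgn ((W *\<^sub>v x) $ i) * (W *\<^sub>v d) $ i)"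
  define D where "D = (\<Sum>j<n. (d $ j)\<^sup>2)"
  \<comment> \<open>\<open>h\<close> is the polynomial that agrees with the objective along
    \<open>x + t d\<close> for small \<open>t\<close>; its derivative at \<open>0\<close> is
    \<open>?L\<close>.\<close>
  define h where "h = (\<lambda>t. objective W y x + t * ?L + t\<^sup>2 / 2 * D)"
  have mv: "(W *\<^sub>v v) $ i = (\<Sum>j<n. W $$ (i, j) * v $ j)" if "i < k" "v \<in> carrier_vec n" for i v
    using W that by (simp add: scalar_prod_def lessThan_atLeast0)
  have quad: "(\<Sum>j<n. ((x + t \<cdot>\<^sub>v d) $ j - y $ j)\<^sup>2)
      = (\<Sum>j<n. (x $ j - y $ j)\<^sup>2) + 2 * t * ((x - y) \<bullet> d) + t\<^sup>2 * D" for t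
  proof -
    have "(\<Sum>j<n. ((x + t \<cdot>\<^sub>v d) $ j - y $ j)\<^sup>2)
      = (\<Sum>j<n. (x $ j - y $ j)\<^sup>2 + 2 * t * ((x $ j - y $ j) * d $ j) + t\<^sup>2 * (d $ j)\<^sup>2)"
      using x d by (intro sum.cong) (auto simp: power2_eq_square algebra_simps)
    then show ?thesis
      using x y d by (simp add: D_def sum.distrib sum_distrib_left scalar_prod_def lessThan_atLeast0)
  qed
  have lin: "(\<Sum>j<n. W $$ (i, j) * (x + t \<cdot>\<^sub>v d) $ j) = (W *\<^sub>v x) $ i + t * (W *\<^sub>v d) $ i"
    if "i < k" for i t
    using x d by (simp add: mv[OF that] sum.distrib sum_distrib_left algebra_simps)
  have absx: "(\<Sum>i<k. \<bar>\<Sum>j<n. W $$ (i, j) * x $ j\<bar>) = (\<Sum>i<k. \<bar>(W *\<^sub>v x) $ i\<bar>)"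
    using x by (intro sum.cong) (auto simp: mv)
  \<comment> \<open>There are finitely many rows, so one neighbourhood of \<open>0\<close> serves
    all of them.\<close>
  have "eventually (\<lambda>t. \<forall>i\<in>{..<k}. \<bar>(W *\<^sub>v x) $ i + t * (W *\<^sub>v d) $ i\<bar>
      = \<bar>(W *\<^sub>v x) $ i\<bar> + t * (sgn ((W *\<^sub>v x) $ i) * (W *\<^sub>v d) $ i)) (nhds 0)"
    by (intro eventually_ball_finite ballI abs_add_eq_sgn) (use stay in auto)
  then have "eventually (\<lambda>t. objective W y (x + t \<cdot>\<^sub>v d) = h t) (nhds 0)"
  proof eventually_elim
    case (elim t)
    have xt: "x + t \<cdot>\<^sub>v d \<in> carrier_vec n" using x d by simp
    show ?case
      unfolding objective_sum[OF W y xt] objective_sum[OF W y x] h_def quad absx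
      using elim by (simp add: lin sum.distrib sum_distrib_left algebra_simps)
  qed
  then obtain e where e: "e > 0" "\<And>t. \<bar>t\<bar> < e \<Longrightarrow> objective W y (x + t \<cdot>\<^sub>v d) = h t"
    unfolding eventually_nhds_metric by (auto simp: dist_real_def)
  have "(h has_real_derivative ?L) (at 0)"
    unfolding h_def by (auto intro!: derivative_eq_intros)
  moreover have "\<forall>t. \<bar>0 - t\<bar> < e \<longrightarrow> h 0 \<le> h t"
  proof (intro allI impI)
    fix t :: real assume "\<bar>0 - t\<bar> < e"
    then have "h t = objective W y (x + t \<cdot>\<^sub>v d)" using e(2)[of t] by simp
    moreover have "h 0 = objective W y x" by (simp add: h_def)
    ultimately show "h 0 \<le> h t" using min[of "x + t \<cdot>\<^sub>v d"] x d by simp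
  qed
  ultimately show ?thesis using DERIV_local_min e(1) by blast
qed

section \<open>Row selection\<close>

text \<open>\<open>pick I p\<close> is the element of \<open>I\<close> with exactly \<open>p\<close>
  smaller elements in \<open>I\<close>, so \<open>p\<close> can be recovered from it; counting then
  gives surjectivity.\<close>

lemma bij_betw_pick:
  assumes "finite I"
  shows "bij_betw (pick I) {..<card I} I"
  unfolding bij_betw_def
proof
  show inj: "inj_on (pick I) {..<card I}"
    by (intro inj_onI) (metis card_pick lessThan_iff)
  have "pick I ` {..<card I} \<subseteq> I" using pick_in_set_le by auto
  then show "pick I ` {..<card I} = I"
    using assms inj by (metis card_image card_lessThan card_subset_eq)
qed

text \<open>The length counts only the indices of \<open>I\<close> below \<open>dim_row A\<close>,
  because \<open>submatrix\<close> ignores those out of range.\<close>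

lemma select_rows_mult_vec_eq:
  "select_rows A I *\<^sub>v v = vec (card {i. i < dim_row A \<and> i \<in> I}) (\<lambda>p. row A (pick I p) \<bullet> v)"
  (is "_ = ?u")
proof (rule eq_vecI)
  fix p assume "p < dim_vec ?u"
  then have p: "p < card {i. i < dim_row A \<and> i \<in> I}" by simp
  have "pick I p < dim_row A" using pick_le[OF p] .
  then have "row (select_rows A I) p = row A (pick I p)"
    using p by (intro eq_vecI) (simp_all add: select_rows_def submatrix_def pick_UNIV)
  then show "(select_rows A I *\<^sub>v v) $ p = ?u $ p"
    using p by (simp add: select_rows_def dim_submatrix)
qed (simp add: select_rows_def dim_submatrix)

lemma select_rows_carrier:
  "A \<in> carrier_mat m n \<Longrightarrow> I \<subseteq> {..<m} \<Longrightarrow> select_rows A I \<in> carrier_mat (card I) n"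
  by (intro carrier_matI) (auto simp: select_rows_def dim_submatrix intro!: arg_cong[where f = card])

lemma select_rows_mult_vec:
  assumes "A \<in> carrier_mat m n" "I \<subseteq> {..<m}" "v \<in> carrier_vec n" "p < card I"
  shows "pick I p \<in> I" and "(select_rows A I *\<^sub>v v) $ p = (A *\<^sub>v v) $ pick I p"
proof -
  show p: "pick I p \<in> I" by (rule pick_in_set_le[OF assms(4)])
  have "{i. i < m \<and> i \<in> I} = I" using assms(2) by auto
  moreover have "pick I p < m" using p assms(2) by auto
  ultimately show "(select_rows A I *\<^sub>v v) $ p = (A *\<^sub>v v) $ pick I p"
    using assms by (simp add: select_rows_mult_vec_eq)
qed

section \<open>The projection formula\<close>

theorem theorem1:
  fixes n k :: nat
    and y xs s :: "real vec"
    and W W0 Wpm R :: "real mat"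
    and K0 Kpm :: "nat set"
  assumes "y \<in> carrier_vec n"
    and "W \<in> carrier_mat k n"
    and "xs = x_star W y"
    and "K0 = {i \<in> {..<k}. (W *\<^sub>v xs) $ i = 0}"
    and "Kpm = {i \<in> {..<k}. (W *\<^sub>v xs) $ i \<noteq> 0}"
    and "W0 = select_rows W K0"
    and "Wpm = select_rows W Kpm"
    and "R = select_rows (1\<^sub>m k) Kpm"
    and "s = R *\<^sub>v sign_vec (W *\<^sub>v xs)"
  shows "xs = null_projector W0 *\<^sub>v (y - transpose_mat Wpm *\<^sub>v s) \<and>
    is_orthogonal_projector n (null_projector W0) (mat_kernel W0)"
proof -
  note y = assms(1) and W = assms(2)
  have x: "xs \<in> carrier_vec n" and min: "\<And>z. z \<in> carrier_vec n \<Longrightarrow> objective W y xs \<le> objective W y z"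
    using x_star_minimizer[OF W y] assms(3) by auto
  have K: "K0 \<subseteq> {..<k}" "Kpm \<subseteq> {..<k}" "finite K0" "finite Kpm" using assms(4,5) by auto
  have W0: "W0 \<in> carrier_mat (card K0) n" and Wpm: "Wpm \<in> carrier_mat (card Kpm) n"
    and R: "R \<in> carrier_mat (card Kpm) k"
    using select_rows_carrier[OF W K(1)] select_rows_carrier[OF W K(2)]
      select_rows_carrier[OF one_carrier_mat K(2)] assms(6-8) by auto
  have sv: "sign_vec (W *\<^sub>v xs) \<in> carrier_vec k" using W by (simp add: sign_vec_def carrier_vecI)
  have s: "s \<in> carrier_vec (card Kpm)" using R assms(9) by (simp add: carrier_vecI)
  define P where "P = null_projector W0"
  have orth: "is_orthogonal_projector n P (mat_kernel W0)"
    unfolding P_def by (rule null_projector_orthogonal(1)[OF W0])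
  then have P: "P \<in> carrier_mat n n" "transpose_mat P = P"
    and Pker: "\<And>v. v \<in> carrier_vec n \<Longrightarrow> P *\<^sub>v v \<in> mat_kernel W0"
    by (auto simp: is_orthogonal_projector_def)
  \<comment> \<open>Reindexing by \<open>pick K0\<close> expresses the nullspace of
    \<open>W0\<close> through the entries of \<open>W v\<close>, the form required by
    \<open>stationary_direction\<close>.\<close>
  have ker: "v \<in> mat_kernel W0 \<longleftrightarrow> (\<forall>i\<in>K0. (W *\<^sub>v v) $ i = 0)" if v: "v \<in> carrier_vec n" for v
  proof -
    have "v \<in> mat_kernel W0 \<longleftrightarrow> W0 *\<^sub>v v = 0\<^sub>v (card K0)"
      using v by (simp add: mat_kernel[OF W0])
    also have "\<dots> \<longleftrightarrow> (\<forall>p<card K0. (W *\<^sub>v v) $ pick K0 p = 0)"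
      using W0 select_rows_mult_vec(2)[OF W K(1) v] assms(6) by (auto simp: vec_eq_iff)
    also have "\<dots> \<longleftrightarrow> (\<forall>i\<in>pick K0 ` {..<card K0}. (W *\<^sub>v v) $ i = 0)" by auto
    finally show ?thesis unfolding bij_betw_imp_surj_on[OF bij_betw_pick[OF K(3)]] .
  qed
  have xker: "xs \<in> mat_kernel W0" using ker[OF x] assms(4) by auto
  have gradient: "(transpose_mat Wpm *\<^sub>v s) \<bullet> d = (\<Sum>i<k. sgn ((W *\<^sub>v xs) $ i) * (W *\<^sub>v d) $ i)"
    if d: "d \<in> carrier_vec n" for d
  proof -
    \<comment> \<open>\<open>R\<close> consists of rows of the identity matrix, so \<open>R\<close>
      applied to a vector reads off its entries at \<open>pick Kpm p\<close>.\<close>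
    have sp: "s $ p = sgn ((W *\<^sub>v xs) $ pick Kpm p)" if "p < card Kpm" for p
    proof -
      have "pick Kpm p < k" using select_rows_mult_vec(1)[OF W K(2) d that] K(2) by auto
      then show ?thesis
        using select_rows_mult_vec(2)[OF one_carrier_mat K(2) sv that] sv W assms(8,9)
        by (simp add: sign_vec_def)
    qed
    have "(transpose_mat Wpm *\<^sub>v s) \<bullet> d = s \<bullet> (Wpm *\<^sub>v d)"
      by (rule transpose_vec_mult_scalar[OF Wpm d s])
    also have "\<dots> = (\<Sum>p<card Kpm. s $ p * (Wpm *\<^sub>v d) $ p)"
      using Wpm by (simp add: scalar_prod_def lessThan_atLeast0)
    also have "\<dots> = (\<Sum>p<card Kpm. sgn ((W *\<^sub>v xs) $ pick Kpm p) * (W *\<^sub>v d) $ pick Kpm p)"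
      using select_rows_mult_vec(2)[OF W K(2) d] assms(7) by (intro sum.cong) (auto simp: sp)
    also have "\<dots> = (\<Sum>i\<in>Kpm. sgn ((W *\<^sub>v xs) $ i) * (W *\<^sub>v d) $ i)"
      by (rule sum.reindex_bij_betw[OF bij_betw_pick[OF K(4)]])
    \<comment> \<open>The indices outside \<open>Kpm\<close> contribute nothing because
      \<open>sgn 0 = 0\<close>.\<close>
    also have "\<dots> = (\<Sum>i<k. sgn ((W *\<^sub>v xs) $ i) * (W *\<^sub>v d) $ i)"
      using assms(5) by (intro sum.mono_neutral_left) auto
    finally show ?thesis .
  qed
  define u where "u = y - transpose_mat Wpm *\<^sub>v s"
  have Ts: "transpose_mat Wpm *\<^sub>v s \<in> carrier_vec n" using Wpm s by simp
  have u: "u \<in> carrier_vec n" using y Ts by (simp add: u_def)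
  have "P *\<^sub>v (u - xs) = 0\<^sub>v n"
  proof -
    define d where "d = P *\<^sub>v (u - xs)"
    have d: "d \<in> carrier_vec n" using P u x by (simp add: d_def)
    have Pd: "P *\<^sub>v d = d"
      unfolding P_def using Pker[of "u - xs"] u x
      by (intro null_projector_orthogonal(2)[OF W0]) (simp add: d_def)
    have "d \<in> mat_kernel W0" using Pker[of "u - xs"] u x by (simp add: d_def)
    then have "(xs - y) \<bullet> d + (transpose_mat Wpm *\<^sub>v s) \<bullet> d = 0"
      unfolding gradient[OF d]
      by (intro stationary_direction[OF W y x min d]) (use ker[OF d] assms(4) in auto)
    then have ud: "(u - xs) \<bullet> d = 0"
      using y x d Ts by (simp add: u_def minus_scalar_prod_distrib[of _ n])
    \<comment> \<open>Symmetry of \<open>P\<close> moves it from the left factor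
      \<open>d = P (u - xs)\<close> to the right one, where \<open>P d = d\<close>. The
      orthogonality \<open>ud\<close> then makes the squared norm of \<open>d\<close> zero.\<close>
    have "d \<bullet> d = (u - xs) \<bullet> (P *\<^sub>v d)"
      using transpose_vec_mult_scalar[OF P(1) d, of "u - xs"] P u x by (simp add: d_def)
    then have "d \<bullet> d = 0" using ud Pd by simp
    then show ?thesis using d conjugate_square_eq_0_vec[OF d] unfolding d_def[symmetric]
      by simp
  qed
  then have "P *\<^sub>v u = P *\<^sub>v xs"
    using P u x by (simp add: mult_minus_distrib_mat_vec[of _ n n] vec_eq_iff)
  also have "\<dots> = xs" unfolding P_def by (rule null_projector_orthogonal(2)[OF W0 xker])
  finally show ?thesis using orth by (simp add: P_def u_def)
qed

end
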